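(* Suppose that $D$ is (strictly) increasing. Then, for every $\varepsilon>0$, the binary search algorithm described in the context, run with a suitable choice of its accuracy parameter $\rho>0$, computes in time $O\left(S\log\frac{S}{\varepsilon}\right)$ a $(1+\varepsilon)$-approximation for P$^{\max}_{\text{no return}}$ (when this problem is feasible), i.e. a feasible solution $(\boldsymbol d,\boldsymbol y)$ with $g^{\max}(\boldsymbol d,\boldsymbol y)\leq(1+\varepsilon)OPT$, where $OPT$ is the optimal value of P$^{\max}_{\text{no return}}$.
   Context: Data: a positive integer $S$ (number of shuttles), a capacity $C\geq 0$, a period length $T$, a loading rate $\nu\geq 0$, and a nondecreasing upper semicontinuous function $D:[0,T]\to\mathbb{R}_+$ with $D(T)>0$ (cumulative demand). Pseudo-inverses of $D$: for $y\in[0,D(T)]$, $\tau(y)=\inf\{t\in[0,T]: D(t)>y\}$ if $y<D(T)$ and $\tau(D(T))=T$; $\bar\tau(y)=\inf\{t\in[0,T]: D(t)\geq y\}$. Problem P$^{\max}_{\text{no return}}$: over nonnegative reals $\boldsymbol d=(d_1,\dots,d_S)$, $\boldsymbol y=(y_1,\dots,y_S)$, with $y_0=0$, minimize $$g^{\max}(\boldsymbol d,\boldsymbol y)=\max_{j:\,y_j>y_{j-1}}\big(d_j-\tau(y_{j-1})\big)$$ subject to: (i) $y_j-y_{j-1}\leq C$ for $j=1,\dots,S$; (ii) $y_{j-1}\leq y_j$ for $j=1,\dots,S$; (iii) $d_{j-1}\leq d_j$ for $j=2,\dots,S$; (iv) $y_S=D(T)$; (v) $\bar\tau(y_j)+\nu(y_j-y_{j-1})\leq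 d_j$ for $j=1,\dots,S$. Algorithm (with accuracy parameter $\rho>0$; there is no feasible solution if $CS<D(T)$, so assume $CS\geq D(T)$). For $h\geq 0$ let (S$_h$) be the system: $y_0=0$; $y_j=\sup\mathcal S_j^h$ for $j=1,\dots,S$; $y_S=D(T)$; $d_j=h+\tau(y_{j-1})$ for $j=1,\dots,S$; where $\mathcal S_j^h=\{y\in\mathbb{R}_+: y\leq C+y_{j-1},\ \bar\tau(y)+\nu(y-y_{j-1})-\tau(y_{j-1})\leq h,\ y\leq D(T)\}$. Start with $h^+=T+\nu D(T)$ and $h^-=0$. While $h^+-h^->\rho$, set $h=(h^++h^-)/2$ and decide whether (S$_h$) has a solution by computing the $y_j$ and $d_j$ iteratively; if yes set $h^+:=h$, otherwise set $h^-:=h$. At the end, output the solution of (S$_{h^+}$). Computational model: the following operations take constant time: evaluation of $D(t)$ for any $t\in[0,T]$; integration of $D$ between two values; evaluation of $\tau(y)$ and $\bar\tau(y)$ for any $y$; evaluation of $\sup\{y:\bar\tau(y)+\nu y\leq\alpha\}$ for any $\alpha\in\mathbb{R}_+$. The quantities $C$, $T$, $D(\cdot)$, $\nu$ are constants of the computational model (the constants hidden in the $O$-notation may depend on them). *)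

theory Defs
  imports "HOL-Analysis.Analysis" "HOL-Library.Monad_Syntax"
begin

section \<open>The optimization problem\<close>

definition upper_semicontinuous_on :: "real set \<Rightarrow> (real \<Rightarrow> real) \<Rightarrow> bool" where
  "upper_semicontinuous_on A f \<longleftrightarrow>
     (\<forall>x\<in>A. \<forall>a>f x. eventually (\<lambda>t. f t < a) (at x within A))"

text \<open>
  Cumulative demand on \<open>[0, T]\<close>; the values of \<open>D\<close> outside \<open>[0, T]\<close> are never used.
\<close>

definition cumulative_demand :: "real \<Rightarrow> (real \<Rightarrow> real) \<Rightarrow> bool" where
  "cumulative_demand T D \<longleftrightarrow>
     mono_on {0..T} D \<and> upper_semicontinuous_on {0..T} D \<and> (\<forall>t\<in>{0..T}. 0 \<le> D t) \<and> 0 < D T"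

text \<open>The two pseudo-inverses of \<open>D\<close> are meaningful only for \<open>y \<in> [0, D T]\<close>.\<close>

definition tau :: "real \<Rightarrow> (real \<Rightarrow> real) \<Rightarrow> real \<Rightarrow> real" where
  "tau T D y = (if y < D T then Inf {t \<in> {0..T}. D t > y} else T)"

definition tau_bar :: "real \<Rightarrow> (real \<Rightarrow> real) \<Rightarrow> real \<Rightarrow> real" where
  "tau_bar T D y = Inf {t \<in> {0..T}. D t \<ge> y}"

text \<open>
  Vectors indexed by \<open>1, \<dots>, S\<close> are functions on \<open>nat\<close>, of which only the values at \<open>1, \<dots>, S\<close>
  (and \<open>y 0 = 0\<close>) matter.
\<close>

definition feasible ::
  "real \<Rightarrow> real \<Rightarrow> real \<Rightarrow> (real \<Rightarrow> real) \<Rightarrow> nat \<Rightarrow> (nat \<Rightarrow> real) \<Rightarrow> (nat \<Rightarrow> real) \<Rightarrow> bool" where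
  "feasible C T \<nu> D S d y \<longleftrightarrow>
     y 0 = 0 \<and>
     (\<forall>j\<in>{1..S}. 0 \<le> d j \<and> 0 \<le> y j) \<and>
     (\<forall>j\<in>{1..S}. y j - y (j - 1) \<le> C) \<and>
     (\<forall>j\<in>{1..S}. y (j - 1) \<le> y j) \<and>
     (\<forall>j\<in>{2..S}. d (j - 1) \<le> d j) \<and>
     y S = D T \<and>
     (\<forall>j\<in>{1..S}. tau_bar T D (y j) + \<nu> * (y j - y (j - 1)) \<le> d j)"

text \<open>For feasible \<open>(d, y)\<close> the maximum is over a nonempty set, since \<open>y 0 = 0 < D T = y S\<close>.\<close>

definition g_max ::
  "real \<Rightarrow> (real \<Rightarrow> real) \<Rightarrow> nat \<Rightarrow> (nat \<Rightarrow> real) \<Rightarrow> (nat \<Rightarrow> real) \<Rightarrow> real" where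
  "g_max T D S d y =
     Max ((\<lambda>j. d j - tau T D (y (j - 1))) ` {j \<in> {1..S}. y j > y (j - 1)})"

definition OPT :: "real \<Rightarrow> real \<Rightarrow> real \<Rightarrow> (real \<Rightarrow> real) \<Rightarrow> nat \<Rightarrow> real" where
  "OPT C T \<nu> D S = Inf {g_max T D S d y | d y. feasible C T \<nu> D S d y}"


section \<open>The system \<open>(S\<^sub>h)\<close>\<close>

definition S_set ::
  "real \<Rightarrow> real \<Rightarrow> real \<Rightarrow> (real \<Rightarrow> real) \<Rightarrow> real \<Rightarrow> real \<Rightarrow> real set" where
  "S_set C T \<nu> D h y' =
     {y. 0 \<le> y \<and> y \<le> C + y' \<and> tau_bar T D y + \<nu> * (y - y') - tau T D y' \<le> h \<and> y \<le> D T}"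

definition solves_S ::
  "real \<Rightarrow> real \<Rightarrow> real \<Rightarrow> (real \<Rightarrow> real) \<Rightarrow> nat \<Rightarrow> real \<Rightarrow> (nat \<Rightarrow> real) \<Rightarrow> (nat \<Rightarrow> real) \<Rightarrow> bool" where
  "solves_S C T \<nu> D S h d y \<longleftrightarrow>
     y 0 = 0 \<and>
     (\<forall>j\<in>{1..S}. y j = Sup (S_set C T \<nu> D h (y (j - 1)))) \<and>
     y S = D T \<and>
     (\<forall>j\<in>{1..S}. d j = h + tau T D (y (j - 1)))"


section \<open>Computations with running time\<close>

text \<open>
  \<open>Some (v, n)\<close> is a computation that halts with result \<open>v\<close> after \<open>n\<close> elementary operations,
  \<open>None\<close> one that does not halt.
\<close>

type_synonym 'a comp = "('a \<times> nat) option"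

definition return :: "'a \<Rightarrow> 'a comp" where
  "return v = Some (v, 0)"

text \<open>
  \<open>step v\<close> is one constant-time operation with result \<open>v\<close>. It is applied below only to single
  arithmetic operations or comparisons, single array accesses or updates, and single evaluations
  of \<open>D\<close>, of \<open>tau\<close>, or of \<open>sup_le\<close>, the primitive \<open>sup {y. tau_bar y + \<nu> y \<le> \<alpha>}\<close>.
\<close>

definition step :: "'a \<Rightarrow> 'a comp" where
  "step v = Some (v, 1)"

definition bind_comp :: "'a comp \<Rightarrow> ('a \<Rightarrow> 'b comp) \<Rightarrow> 'b comp" where
  "bind_comp m f =
     Option.bind m (\<lambda>vn. Option.bind (f (fst vn)) (\<lambda>wk. Some (fst wk, snd vn + snd wk)))"

no_adhoc_overloading Monad_Syntax.bind \<rightleftharpoons> Option.bind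
adhoc_overloading Monad_Syntax.bind \<rightleftharpoons> bind_comp

lemma bind_comp_mono [partial_function_mono]:
  assumes "mono_option B" and "\<And>v. mono_option (\<lambda>f. G v f)"
  shows "mono_option (\<lambda>f. bind_comp (B f) (\<lambda>v. G v f))"
  unfolding bind_comp_def by (intro bind_mono assms option.const_mono)

partial_function (option) while_comp ::
  "('s \<Rightarrow> bool comp) \<Rightarrow> ('s \<Rightarrow> 's comp) \<Rightarrow> 's \<Rightarrow> 's comp" where
  "while_comp b c s =
     do { t \<leftarrow> b s; if t then do { s' \<leftarrow> c s; while_comp b c s' } else return s }"


section \<open>The binary search algorithm\<close>

definition sup_le :: "real \<Rightarrow> real \<Rightarrow> (real \<Rightarrow> real) \<Rightarrow> real \<Rightarrow> real" where
  "sup_le T \<nu> D \<alpha> = Sup {y \<in> {0..D T}. tau_bar T D y + \<nu> * y \<le> \<alpha>}"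

text \<open>
  The first \<open>n\<close> iterations of the computation of the \<open>y j\<close> and \<open>d j\<close> of \<open>(S\<^sub>h)\<close>. As
  \<open>tau_bar\<close> is nondecreasing, the supremum of \<open>S_set\<close> is \<open>min (C + y') (sup_le \<alpha>)\<close> with
  \<open>\<alpha> = h + tau y' + \<nu> y'\<close>. The last \<open>step\<close> of an iteration is the increment of the loop
  counter. Arrays start with arbitrary contents, so their creation costs nothing.
\<close>

primrec greedy ::
  "real \<Rightarrow> real \<Rightarrow> real \<Rightarrow> (real \<Rightarrow> real) \<Rightarrow> real \<Rightarrow> nat \<Rightarrow> ((nat \<Rightarrow> real) \<times> (nat \<Rightarrow> real)) comp" where
  "greedy C T \<nu> D h 0 =
     do {
       y \<leftarrow> step ((\<lambda>_. undefined)(0 := 0));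
       return (\<lambda>_. undefined, y)
     }"
| "greedy C T \<nu> D h (Suc n) =
     do {
       (d, y) \<leftarrow> greedy C T \<nu> D h n;
       y' \<leftarrow> step (y n);
       t \<leftarrow> step (tau T D y');
       d' \<leftarrow> step (h + t);
       v \<leftarrow> step (\<nu> * y');
       \<alpha> \<leftarrow> step (d' + v);
       u \<leftarrow> step (sup_le T \<nu> D \<alpha>);
       c \<leftarrow> step (C + y');
       y'' \<leftarrow> step (min c u);
       d \<leftarrow> step (d(Suc n := d'));
       y \<leftarrow> step (y(Suc n := y''));
       step (Suc n);
       return (d, y)
     }"

definition solve ::
  "real \<Rightarrow> real \<Rightarrow> real \<Rightarrow> (real \<Rightarrow> real) \<Rightarrow> nat \<Rightarrow> real \<Rightarrow>
     (bool \<times> (nat \<Rightarrow> real) \<times> (nat \<Rightarrow> real)) comp" where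
  "solve C T \<nu> D S h =
     do {
       (d, y) \<leftarrow> greedy C T \<nu> D h S;
       q \<leftarrow> step (D T);
       z \<leftarrow> step (y S);
       ok \<leftarrow> step (z = q);
       return (ok, d, y)
     }"

definition binary_search ::
  "real \<Rightarrow> real \<Rightarrow> real \<Rightarrow> (real \<Rightarrow> real) \<Rightarrow> nat \<Rightarrow> real \<Rightarrow>
     ((nat \<Rightarrow> real) \<times> (nat \<Rightarrow> real)) comp" where
  "binary_search C T \<nu> D S \<rho> =
     do {
       q \<leftarrow> step (D T);
       v \<leftarrow> step (\<nu> * q);
       p \<leftarrow> step (T + v);
       (hplus, hminus) \<leftarrow> while_comp
         (\<lambda>(hplus, hminus). do { w \<leftarrow> step (hplus - hminus); step (w > \<rho>) })
         (\<lambda>(hplus, hminus). do {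
            w \<leftarrow> step (hplus + hminus);
            h \<leftarrow> step (w / 2);
            (ok, _, _) \<leftarrow> solve C T \<nu> D S h;
            return (if ok then (h, hminus) else (hplus, h))
          })
         (p, 0);
       (_, d, y) \<leftarrow> solve C T \<nu> D S hplus;
       return (d, y)
     }"


section \<open>\<^const>\<open>solve\<close> decides and solves \<open>(S\<^sub>h)\<close>\<close>

lemma tau_bar_mono:
  assumes "0 \<le> T" "x \<le> y" "y \<le> D T"
  shows "tau_bar T D x \<le> tau_bar T D y"
  unfolding tau_bar_def
proof (rule cInf_superset_mono)
  show "{t \<in> {0..T}. y \<le> D t} \<noteq> {}" using assms by force
  show "bdd_below {t \<in> {0..T}. x \<le> D t}" by (rule bdd_belowI[of _ 0]) auto
qed (use assms in auto)

lemma tau_bar_0: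
  assumes "0 \<le> T" "cumulative_demand T D"
  shows "tau_bar T D 0 = 0"
proof -
  have "{t \<in> {0..T}. D t \<ge> 0} = {0..T}" using assms by (auto simp: cumulative_demand_def)
  then show ?thesis using assms by (simp add: tau_bar_def)
qed

lemma tau_nonneg:
  assumes "0 \<le> T"
  shows "0 \<le> tau T D y"
proof (cases "y < D T")
  case True
  then have "{t \<in> {0..T}. D t > y} \<noteq> {}" using assms by force
  then have "0 \<le> Inf {t \<in> {0..T}. D t > y}" by (rule cInf_greatest) auto
  then show ?thesis using True by (simp add: tau_def)
qed (use assms in \<open>simp add: tau_def\<close>)

lemma Sup_S_set:
  assumes "0 \<le> C" "0 \<le> T" "0 \<le> \<nu>" "cumulative_demand T D" "0 \<le> h" "0 \<le> y'"
  defines "m \<equiv> min (C + y') (sup_le T \<nu> D (h + tau T D y' + \<nu> * y'))"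
  shows "Sup (S_set C T \<nu> D h y') = m" "0 \<le> m" "m \<le> D T"
proof -
  define \<alpha> where "\<alpha> = h + tau T D y' + \<nu> * y'"
  define L where "L = {y \<in> {0..D T}. tau_bar T D y + \<nu> * y \<le> \<alpha>}"
  have "0 \<le> \<alpha>" using assms tau_nonneg[of T D y'] by (simp add: \<alpha>_def)
  then have L0: "0 \<in> L" using assms tau_bar_0[of T D] by (simp add: L_def cumulative_demand_def)
  have bdd: "bdd_above L" by (rule bdd_aboveI[of _ "D T"]) (auto simp: L_def)
  have down: "x \<in> L" if "z \<in> L" "0 \<le> x" "x \<le> z" for x z
    using that tau_bar_mono[of T x z D] mult_left_mono[of x z \<nu>] assms
    by (auto simp: L_def)
  have s0: "0 \<le> Sup L" by (rule cSup_upper[OF L0 bdd])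
  have sD: "Sup L \<le> D T" by (rule cSup_least) (use L0 in \<open>auto simp: L_def\<close>)
  have m: "m = min (C + y') (Sup L)" by (simp add: m_def sup_le_def L_def \<alpha>_def)
  then show "0 \<le> m" "m \<le> D T" using s0 sD assms by auto
  have S: "S_set C T \<nu> D h y' = {y \<in> L. y \<le> C + y'}"
    by (auto simp: S_set_def L_def \<alpha>_def algebra_simps)
  show "Sup (S_set C T \<nu> D h y') = m"
  proof (cases "C + y' < Sup L")
    case True
    then obtain z where "z \<in> L" "C + y' < z" using less_cSup_iff[of L] L0 bdd by blast
    then have "C + y' \<in> L" using down[of z "C + y'"] assms by simp
    then have "Sup {y \<in> L. y \<le> C + y'} = C + y'" by (intro cSup_eq_maximum) auto
    then show ?thesis using S m True by simp
  next
    case False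
    have "{y \<in> L. y \<le> C + y'} = L" using False cSup_upper[OF _ bdd] by force
    then show ?thesis using S m False by simp
  qed
qed

lemma greedy_correct:
  assumes "0 \<le> C" "0 \<le> T" "0 \<le> \<nu>" "cumulative_demand T D" "0 \<le> h"
  shows "\<exists>d y t. greedy C T \<nu> D h n = Some ((d, y), t) \<and> y 0 = 0 \<and> (\<forall>j\<le>n. 0 \<le> y j) \<and>
    (\<forall>j\<in>{1..n}. y j = Sup (S_set C T \<nu> D h (y (j - 1))) \<and> d j = h + tau T D (y (j - 1)))"
proof (induction n)
  case 0
  show ?case by (simp add: step_def return_def bind_comp_def)
next
  case (Suc n)
  then obtain d y t where IH: "greedy C T \<nu> D h n = Some ((d, y), t)" "y 0 = 0" "\<forall>j\<le>n. 0 \<le> y j"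
    "\<forall>j\<in>{1..n}. y j = Sup (S_set C T \<nu> D h (y (j - 1))) \<and> d j = h + tau T D (y (j - 1))"
    by blast
  define m where "m = min (C + y n) (sup_le T \<nu> D (h + tau T D (y n) + \<nu> * y n))"
  have "0 \<le> y n" using IH by simp
  from Sup_S_set[OF assms this] have m: "Sup (S_set C T \<nu> D h (y n)) = m" "0 \<le> m"
    by (simp_all add: m_def)
  have run: "\<exists>t. greedy C T \<nu> D h (Suc n) = Some ((d(Suc n := h + tau T D (y n)), y(Suc n := m)), t)"
    using IH(1) by (simp add: step_def return_def bind_comp_def m_def)
  let ?d = "d(Suc n := h + tau T D (y n))" and ?y = "y(Suc n := m)"
  have "?y j = Sup (S_set C T \<nu> D h (?y (j - 1))) \<and> ?d j = h + tau T D (?y (j - 1))"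
    if j: "j \<in> {1..Suc n}" for j
  proof (cases "j = Suc n")
    case True
    then show ?thesis using m(1) by simp
  next
    case False
    then have "j \<in> {1..n}" "j - 1 \<noteq> Suc n" using j by auto
    with IH(4) False show ?thesis by (metis fun_upd_other)
  qed
  moreover have "?y 0 = 0" "\<forall>j\<le>Suc n. 0 \<le> ?y j" using IH(2,3) m(2) by auto
  ultimately show ?case using run by blast
qed

lemma solve_correct:
  assumes "0 \<le> C" "0 \<le> T" "0 \<le> \<nu>" "cumulative_demand T D" "0 \<le> h"
  shows "\<exists>ok d y t. solve C T \<nu> D S h = Some ((ok, d, y), t) \<and>
    (if ok then solves_S C T \<nu> D S h d y else \<nexists>d y. solves_S C T \<nu> D S h d y)"
proof -
  from greedy_correct[OF assms, of S] obtain d y t where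
    gr: "greedy C T \<nu> D h S = Some ((d, y), t)" "y 0 = 0"
    "\<forall>j\<in>{1..S}. y j = Sup (S_set C T \<nu> D h (y (j - 1))) \<and> d j = h + tau T D (y (j - 1))"
    by blast
  have run: "\<exists>t. solve C T \<nu> D S h = Some ((y S = D T, d, y), t)"
    using gr(1) by (simp add: solve_def step_def return_def bind_comp_def)
  have "y S = D T" if sol: "solves_S C T \<nu> D S h d' y'" for d' y'
  proof -
    have "y' j = y j" if "j \<le> S" for j
      using that
    proof (induction j)
      case 0
      then show ?case using sol gr(2) by (simp add: solves_S_def)
    next
      case (Suc j)
      then have "Suc j \<in> {1..S}" by simp
      then have "y' (Suc j) = Sup (S_set C T \<nu> D h (y' j))" "y (Suc j) = Sup (S_set C T \<nu> D h (y j))"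
        using sol gr(3) unfolding solves_S_def by (metis diff_Suc_1)+
      then show ?case using Suc by simp
    qed
    then show ?thesis using sol by (simp add: solves_S_def)
  qed
  moreover have "solves_S C T \<nu> D S h d y" if "y S = D T"
    unfolding solves_S_def using gr(2,3) that by blast
  ultimately show ?thesis using run by metis
qed

end

theory Submission
  imports Defs
begin

text \<open>
  Put \<open>h0 = T + \<nu> * D T\<close>. The proof rests on three facts.

  First, the greedy solution of the system with parameter \<open>h\<close> is itself feasible, with objective
  value exactly \<open>h\<close> (\<open>solves_S_feasible\<close>). The delicate constraint is that the supremum
  defining a load satisfies the departure constraint, which amounts to \<open>tau_bar\<close> being
  left-continuous (\<open>Sup_S_set_mem\<close>).

  Second, the greedy loads dominate the loads of every competitor whose departures all fit within
  \<open>h\<close> (\<open>greedy_dominates\<close>), because the set of admissible loads only grows with the previous load.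
  So the system is solvable for \<open>h\<close> as soon as some feasible solution has objective value at most
  \<open>h\<close>, and also for \<open>h0\<close> whenever the problem is feasible at all. Therefore bisection keeps the
  system solvable at the upper bound, while the lower bound never exceeds the optimum.

  Third, for a strictly increasing demand the two pseudo-inverses coincide, so the delays
  \<open>tau_bar (y j) + \<nu> * (y j - y (j - 1)) - tau (y (j - 1))\<close> telescope to \<open>h0\<close>. The objective
  bounds each of the \<open>S\<close> delays, hence \<open>h0 / S\<close> bounds the optimum from below
  (\<open>OPT_ge_average\<close>). With accuracy \<open>\<rho> = \<epsilon> * h0 / S\<close>, the final gap is thus at most \<open>\<epsilon>\<close> times
  the optimum. Bisection reaches it from the initial gap \<open>h0\<close> after at most \<open>\<lceil>log 2 (S / \<epsilon>)\<rceil>\<close>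
  halvings (none when this is negative), each of which costs time linear in \<open>S\<close>.
\<close>

section \<open>The pseudo-inverses of the demand\<close>

locale demand =
  fixes C T \<nu> :: real and D :: "real \<Rightarrow> real"
  assumes C_nonneg: "0 \<le> C" and T_nonneg: "0 \<le> T" and \<nu>_nonneg: "0 \<le> \<nu>"
    and demand: "cumulative_demand T D"
begin

lemma D_mono: "0 \<le> s \<Longrightarrow> s \<le> t \<Longrightarrow> t \<le> T \<Longrightarrow> D s \<le> D t"
  using demand by (auto simp: cumulative_demand_def mono_on_def)

lemma DT_pos: "0 < D T"
  using demand by (simp add: cumulative_demand_def)

lemma tau_le:
  assumes "0 \<le> t" "t \<le> T" "y < D t"
  shows "tau T D y \<le> t"
proof -
  have "y < D T" using assms D_mono[of t T] by simp
  moreover have "Inf {t \<in> {0..T}. D t > y} \<le> t"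
    by (rule cInf_lower) (use assms in \<open>auto intro: bdd_belowI[of _ 0]\<close>)
  ultimately show ?thesis by (simp add: tau_def)
qed

lemma tau_le_T: "tau T D y \<le> T"
  using tau_le[of T y] T_nonneg by (cases "y < D T") (auto simp: tau_def)

lemma tau_ge:
  assumes "x \<le> T" "\<And>t. 0 \<le> t \<Longrightarrow> t \<le> T \<Longrightarrow> y < D t \<Longrightarrow> x \<le> t"
  shows "x \<le> tau T D y"
proof (cases "y < D T")
  case True
  then have "{t \<in> {0..T}. D t > y} \<noteq> {}" using T_nonneg by force
  then have "x \<le> Inf {t \<in> {0..T}. D t > y}" by (rule cInf_greatest) (use assms in auto)
  then show ?thesis using True by (simp add: tau_def)
qed (use assms in \<open>simp add: tau_def\<close>)

lemma tau_mono: "x \<le> y \<Longrightarrow> tau T D x \<le> tau T D y"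
  by (rule tau_ge[OF tau_le_T]) (auto intro: tau_le)

lemma tau_bar_le:
  assumes "0 \<le> t" "t \<le> T" "y \<le> D t"
  shows "tau_bar T D y \<le> t"
  unfolding tau_bar_def
  by (rule cInf_lower) (use assms in \<open>auto intro: bdd_belowI[of _ 0]\<close>)

lemma tau_bar_ge:
  assumes "y \<le> D T" "\<And>t. 0 \<le> t \<Longrightarrow> t \<le> T \<Longrightarrow> y \<le> D t \<Longrightarrow> x \<le> t"
  shows "x \<le> tau_bar T D y"
proof -
  have "{t \<in> {0..T}. y \<le> D t} \<noteq> {}" using T_nonneg assms(1) by force
  then show ?thesis unfolding tau_bar_def by (rule cInf_greatest) (use assms in auto)
qed

lemma tau_bar_less_iff:
  assumes "y \<le> D T"
  shows "tau_bar T D y < x \<longleftrightarrow> (\<exists>t. 0 \<le> t \<and> t \<le> T \<and> t < x \<and> y \<le> D t)"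
  using tau_bar_le tau_bar_ge[OF assms] by (meson le_less_trans not_le)

lemma tau_bar_le_tau: "y \<le> D T \<Longrightarrow> tau_bar T D y \<le> tau T D y"
  by (rule tau_ge) (auto intro: tau_bar_le T_nonneg)

lemma tau_le_tau_bar: "x < y \<Longrightarrow> y \<le> D T \<Longrightarrow> tau T D x \<le> tau_bar T D y"
  by (rule tau_bar_ge) (auto intro: tau_le)

text \<open>
  Strictness leaves no flat pieces, the only places where the pseudo-inverses could differ:
  a level attained at \<open>t < T\<close> is exceeded immediately after \<open>t\<close>.
\<close>

lemma tau_eq_tau_bar:
  assumes "strict_mono_on {0..T} D" "y \<le> D T"
  shows "tau T D y = tau_bar T D y"
proof (rule antisym)
  show "tau T D y \<le> tau_bar T D y"
  proof (rule tau_bar_ge[OF assms(2)])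
    fix t assume t: "0 \<le> t" "t \<le> T" "y \<le> D t"
    show "tau T D y \<le> t"
    proof (rule dense_ge)
      fix u assume u: "t < u"
      show "tau T D y \<le> u"
      proof (cases "u \<le> T")
        case True
        then have "D t < D u" using assms(1) t u by (auto simp: strict_mono_on_def)
        then show ?thesis using tau_le[of u y] True t u by simp
      qed (use tau_le_T[of y] in simp)
    qed
  qed
qed (rule tau_bar_le_tau[OF assms(2)])


section \<open>Greedy solutions are feasible\<close>

lemma zero_mem_S_set:
  assumes "0 \<le> h" "0 \<le> y'"
  shows "0 \<in> S_set C T \<nu> D h y'"
proof -
  have "0 \<le> \<nu> * y'" using \<nu>_nonneg assms by simp
  then show ?thesis
    using assms C_nonneg DT_pos tau_bar_0[OF T_nonneg demand] tau_nonneg[OF T_nonneg, of D y']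
    by (simp add: S_set_def)
qed

lemma bdd_above_S_set: "bdd_above (S_set C T \<nu> D h y')"
  by (rule bdd_aboveI[of _ "D T"]) (auto simp: S_set_def)

text \<open>
  Left-continuity of \<open>tau_bar\<close>: if every level slightly below \<open>s\<close> has been reached before
  time \<open>t\<close>, then monotonicity of the demand gives \<open>s \<le> D t\<close>.
\<close>

lemma Sup_S_set_mem:
  assumes "0 \<le> h" "0 \<le> y'"
  shows "Sup (S_set C T \<nu> D h y') \<in> S_set C T \<nu> D h y'"
proof -
  let ?A = "S_set C T \<nu> D h y'"
  define s where "s = Sup ?A"
  define \<beta> where "\<beta> = h + tau T D y' + \<nu> * y' - \<nu> * s"
  have ne: "?A \<noteq> {}" using zero_mem_S_set[OF assms] by blast
  have s: "0 \<le> s" "s \<le> C + y'" "s \<le> D T"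
    using Sup_S_set[OF C_nonneg T_nonneg \<nu>_nonneg demand assms] by (auto simp: s_def)
  have "tau_bar T D s \<le> \<beta>"
  proof (rule dense_ge)
    fix t assume t: "\<beta> < t"
    show "tau_bar T D s \<le> t"
    proof (cases "t \<le> T")
      case False
      then show ?thesis using tau_bar_le[of T s] T_nonneg s by simp
    next
      case True
      have near: "0 \<le> t \<and> x \<le> D t" if "x < s" for x
      proof -
        \<comment> \<open>Below \<open>s\<close> by less than this margin, the loading time saved is less than \<open>t - \<beta>\<close>.\<close>
        define \<delta> where "\<delta> = (t - \<beta>) / (\<nu> + 1)"
        have "0 < \<delta>" using t \<nu>_nonneg by (simp add: \<delta>_def)
        then have "max x (s - \<delta>) < s" using that by simp
        then obtain z where z: "z \<in> ?A" "max x (s - \<delta>) < z"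
          using less_cSupD[OF ne, of "max x (s - \<delta>)"] by (auto simp: s_def)
        have "\<nu> * (s - z) \<le> \<nu> * \<delta>" using z \<nu>_nonneg by (intro mult_left_mono) auto
        also have "\<dots> < (\<nu> + 1) * \<delta>" using \<open>0 < \<delta>\<close> by simp
        also have "\<dots> = t - \<beta>" using \<nu>_nonneg by (simp add: \<delta>_def)
        finally have "\<nu> * (s - z) < t - \<beta>" .
        moreover have "tau_bar T D z + \<nu> * (z - y') - tau T D y' \<le> h" "z \<le> D T"
          using z(1) by (auto simp: S_set_def)
        ultimately have "tau_bar T D z < t" by (simp add: \<beta>_def algebra_simps)
        then obtain u where "0 \<le> u" "u < t" "z \<le> D u"
          using tau_bar_less_iff[OF \<open>z \<le> D T\<close>] by blast
        then show ?thesis using D_mono[of u t] True z(2) by simp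
      qed
      have "0 \<le> t" using near[of "s - 1"] by simp
      moreover have "s \<le> D t" by (rule dense_le) (use near in blast)
      ultimately show ?thesis using tau_bar_le[of t s] True by simp
    qed
  qed
  then show ?thesis using s by (simp add: S_set_def s_def \<beta>_def algebra_simps)
qed

lemma self_mem_S_set:
  assumes "0 \<le> h" "0 \<le> y'" "y' \<le> D T"
  shows "y' \<in> S_set C T \<nu> D h y'"
  using assms C_nonneg tau_bar_le_tau[of y'] by (simp add: S_set_def)

lemma feasible_bounds:
  assumes "feasible C T \<nu> D S d y" "j \<le> S"
  shows "0 \<le> y j" "y j \<le> D T"
proof -
  have le_step: "y i \<le> y (Suc i)" if "i < S" for i
  proof -
    have "Suc i \<in> {1..S}" using that by simp
    then show ?thesis using assms(1) unfolding feasible_def by (metis diff_Suc_1)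
  qed
  have "y j \<le> y S" using assms(2)
  proof (induction rule: inc_induct)
    case (step i)
    then show ?case using le_step[of i] by simp
  qed simp
  then show "y j \<le> D T" using assms(1) by (simp add: feasible_def)
  show "0 \<le> y j" using assms by (cases j) (auto simp: feasible_def)
qed

lemma feasible_load_ex:
  assumes "feasible C T \<nu> D S d y"
  shows "\<exists>j\<in>{1..S}. y (j - 1) < y j"
proof (rule ccontr)
  assume no: "\<not> ?thesis"
  have "y j \<le> 0" if "j \<le> S" for j
    using that
  proof (induction j)
    case 0
    then show ?case using assms by (simp add: feasible_def)
  next
    case (Suc j)
    then have "\<not> y (Suc j - 1) < y (Suc j)" using no by force
    with Suc show ?case by simp
  qed
  from this[of S] show False using assms DT_pos by (simp add: feasible_def)
qed

lemma solves_S_feasible: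
  assumes "solves_S C T \<nu> D S h d y" "0 \<le> h"
  shows "feasible C T \<nu> D S d y" "g_max T D S d y = h"
proof -
  have y0: "y 0 = 0" and yS: "y S = D T"
    and yj: "\<And>j. j \<in> {1..S} \<Longrightarrow> y j = Sup (S_set C T \<nu> D h (y (j - 1)))"
    and dj: "\<And>j. j \<in> {1..S} \<Longrightarrow> d j = h + tau T D (y (j - 1))"
    using assms(1) by (auto simp: solves_S_def)
  have bounds: "0 \<le> y j \<and> y j \<le> D T" if "j \<le> S" for j
    using that
  proof (induction j)
    case 0
    then show ?case using y0 DT_pos by simp
  next
    case (Suc j)
    then show ?case
      using yj[of "Suc j"] Sup_S_set[OF C_nonneg T_nonneg \<nu>_nonneg demand assms(2), of "y j"]
      by simp
  qed
  have mem: "y j \<in> S_set C T \<nu> D h (y (j - 1))" and mono: "y (j - 1) \<le> y j"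
    if "j \<in> {1..S}" for j
  proof -
    have b: "0 \<le> y (j - 1)" "y (j - 1) \<le> D T" using bounds[of "j - 1"] that by auto
    show "y j \<in> S_set C T \<nu> D h (y (j - 1))"
      using Sup_S_set_mem[OF assms(2) b(1)] yj[OF that] by simp
    show "y (j - 1) \<le> y j"
      using cSup_upper[OF self_mem_S_set[OF assms(2) b] bdd_above_S_set] yj[OF that] by simp
  qed
  show feas: "feasible C T \<nu> D S d y"
    unfolding feasible_def
  proof (intro conjI ballI)
    fix j assume j: "j \<in> {1..S}"
    show "0 \<le> d j" using dj[OF j] assms(2) tau_nonneg[OF T_nonneg] by simp
    show "0 \<le> y j" using bounds j by simp
    show "y j - y (j - 1) \<le> C" using mem[OF j] by (simp add: S_set_def)
    show "y (j - 1) \<le> y j" using mono[OF j] .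
    show "tau_bar T D (y j) + \<nu> * (y j - y (j - 1)) \<le> d j"
      using mem[OF j] dj[OF j] by (simp add: S_set_def)
  next
    fix j assume j: "j \<in> {2..S}"
    then have "j \<in> {1..S}" "j - 1 \<in> {1..S}" by auto
    then show "d (j - 1) \<le> d j"
      using dj[of j] dj[of "j - 1"] tau_mono[OF mono[of "j - 1"]] by simp
  qed (use y0 yS in auto)
  have "(\<lambda>j. d j - tau T D (y (j - 1))) ` {j \<in> {1..S}. y j > y (j - 1)} = {h}"
    using feasible_load_ex[OF feas] dj by force
  then show "g_max T D S d y = h" by (simp add: g_max_def)
qed


section \<open>Greedy loads dominate\<close>

lemma S_set_mono:
  assumes "x' \<le> y'"
  shows "S_set C T \<nu> D h x' \<subseteq> S_set C T \<nu> D h y'"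
proof
  fix z assume z: "z \<in> S_set C T \<nu> D h x'"
  have "\<nu> * (z - y') \<le> \<nu> * (z - x')" using assms \<nu>_nonneg by (intro mult_left_mono) auto
  then show "z \<in> S_set C T \<nu> D h y'"
    using z assms tau_mono[OF assms] by (auto simp: S_set_def)
qed

lemma greedy_dominates:
  assumes "0 \<le> h" and feas: "feasible C T \<nu> D S d y"
    and fits: "\<And>j. j \<in> {1..S} \<Longrightarrow>
      tau_bar T D (y j) + \<nu> * (y j - y (j - 1)) - tau T D (y (j - 1)) \<le> h"
  shows "\<exists>d y. solves_S C T \<nu> D S h d y"
proof -
  obtain e z where z0: "z 0 = 0" and z_nonneg: "\<forall>j\<le>S. 0 \<le> z j"
    and z: "\<forall>j\<in>{1..S}. z j = Sup (S_set C T \<nu> D h (z (j - 1))) \<and> e j = h + tau T D (z (j - 1))"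
    using greedy_correct[OF C_nonneg T_nonneg \<nu>_nonneg demand assms(1), of S] by blast
  have dom: "y j \<le> z j" if "j \<le> S" for j
    using that
  proof (induction j)
    case 0
    then show ?case using feas z0 by (simp add: feasible_def)
  next
    case (Suc j)
    then have j: "Suc j \<in> {1..S}" by simp
    have "y (Suc j) - y j \<le> C" using feas j unfolding feasible_def by (metis diff_Suc_1)
    then have "y (Suc j) \<in> S_set C T \<nu> D h (y j)"
      using fits[OF j] feasible_bounds[OF feas, of "Suc j"] Suc.prems by (simp add: S_set_def)
    then have "y (Suc j) \<in> S_set C T \<nu> D h (z j)" using S_set_mono[of "y j" "z j"] Suc by auto
    then have "y (Suc j) \<le> Sup (S_set C T \<nu> D h (z j))"
      by (rule cSup_upper[OF _ bdd_above_S_set])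
    also have "\<dots> = z (Suc j)" using bspec[OF z j] by simp
    finally show ?case .
  qed
  have "S \<noteq> 0" using feasible_load_ex[OF feas] by auto
  then have "z S = Sup (S_set C T \<nu> D h (z (S - 1)))" using bspec[OF z, of S] by simp
  then have "z S \<in> S_set C T \<nu> D h (z (S - 1))"
    using Sup_S_set_mem[OF assms(1), of "z (S - 1)"] z_nonneg by simp
  then have "z S \<le> D T" by (simp add: S_set_def)
  moreover have "D T \<le> z S" using dom[of S] feas by (simp add: feasible_def)
  ultimately have "z S = D T" by simp
  then show ?thesis unfolding solves_S_def using z0 z by blast
qed


section \<open>Bounds on the optimum\<close>

lemma g_max_ge:
  assumes "j \<in> {1..S}" "y (j - 1) < y j"
  shows "d j - tau T D (y (j - 1)) \<le> g_max T D S d y"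
  unfolding g_max_def by (rule Max_ge) (use assms in auto)

lemma g_max_nonneg:
  assumes "feasible C T \<nu> D S d y"
  shows "0 \<le> g_max T D S d y"
proof -
  obtain j where j: "j \<in> {1..S}" "y (j - 1) < y j" using feasible_load_ex[OF assms] by blast
  have "tau T D (y (j - 1)) \<le> tau_bar T D (y j)"
    using tau_le_tau_bar j feasible_bounds[OF assms, of j] by simp
  moreover have "tau_bar T D (y j) + \<nu> * (y j - y (j - 1)) \<le> d j"
    using assms j by (simp add: feasible_def)
  moreover have "0 \<le> \<nu> * (y j - y (j - 1))" using j \<nu>_nonneg by simp
  ultimately show ?thesis using g_max_ge[OF j, of d] by linarith
qed

text \<open>
  The objective ranges over the loaded shuttles only, but an empty shuttle has no positive delay.
\<close>

lemma delay_le_g_max: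
  assumes "feasible C T \<nu> D S d y" "j \<in> {1..S}"
  shows "tau_bar T D (y j) + \<nu> * (y j - y (j - 1)) - tau T D (y (j - 1)) \<le> g_max T D S d y"
proof (cases "y (j - 1) < y j")
  case True
  have "tau_bar T D (y j) + \<nu> * (y j - y (j - 1)) \<le> d j" using assms by (simp add: feasible_def)
  then show ?thesis using g_max_ge[OF assms(2) True, of d] by simp
next
  case False
  then have "y (j - 1) = y j" using assms by (force simp: feasible_def)
  then show ?thesis
    using tau_bar_le_tau[OF feasible_bounds(2)[OF assms(1), of j]] g_max_nonneg[OF assms(1)] assms(2)
    by simp
qed

lemma solvable_if_g_max_le:
  assumes "feasible C T \<nu> D S d y" "g_max T D S d y \<le> h"
  shows "\<exists>d y. solves_S C T \<nu> D S h d y"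
proof (rule greedy_dominates[OF _ assms(1)])
  show "0 \<le> h" using g_max_nonneg[OF assms(1)] assms(2) by simp
  show "tau_bar T D (y j) + \<nu> * (y j - y (j - 1)) - tau T D (y (j - 1)) \<le> h"
    if "j \<in> {1..S}" for j
    using delay_le_g_max[OF assms(1) that] assms(2) by linarith
qed

lemma solvable_initially:
  assumes "feasible C T \<nu> D S d y"
  shows "\<exists>d y. solves_S C T \<nu> D S (T + \<nu> * D T) d y"
proof (rule greedy_dominates[OF _ assms])
  show "0 \<le> T + \<nu> * D T" using T_nonneg \<nu>_nonneg DT_pos by simp
next
  fix j assume j: "j \<in> {1..S}"
  have b: "0 \<le> y (j - 1)" "y j \<le> D T"
    using feasible_bounds[OF assms, of j] feasible_bounds[OF assms, of "j - 1"] j by auto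
  have "\<nu> * (y j - y (j - 1)) \<le> \<nu> * D T" using b \<nu>_nonneg by (intro mult_left_mono) auto
  then show "tau_bar T D (y j) + \<nu> * (y j - y (j - 1)) - tau T D (y (j - 1)) \<le> T + \<nu> * D T"
    using tau_bar_le[of T "y j"] T_nonneg tau_nonneg[OF T_nonneg, of D "y (j - 1)"] b by simp
qed

text \<open>
  As \<open>tau = tau_bar\<close>, the delays telescope to \<open>T + \<nu> * D T\<close>: a shuttle's window begins exactly
  where the window of its predecessor ends. So the largest delay is at least the average.
\<close>

lemma g_max_ge_average:
  assumes "strict_mono_on {0..T} D" "feasible C T \<nu> D S d y"
  shows "(T + \<nu> * D T) / S \<le> g_max T D S d y"
proof -
  define F where "F j = tau T D (y j) + \<nu> * y j" for j
  have "tau_bar T D 0 = 0" by (rule tau_bar_0[OF T_nonneg demand])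
  then have F0: "F 0 = 0"
    using tau_eq_tau_bar[OF assms(1), of 0] DT_pos assms(2) by (simp add: F_def feasible_def)
  have FS: "F S = T + \<nu> * D T" using assms(2) by (simp add: F_def feasible_def tau_def)
  have "T + \<nu> * D T = (\<Sum>j<S. F (Suc j) - F j)"
    using sum_lessThan_telescope[of F S] F0 FS by simp
  also have "\<dots> \<le> (\<Sum>j<S. g_max T D S d y)"
  proof (rule sum_mono)
    fix j assume "j \<in> {..<S}"
    then have j: "Suc j \<in> {1..S}" by simp
    then have "tau T D (y (Suc j)) = tau_bar T D (y (Suc j))"
      using tau_eq_tau_bar[OF assms(1)] feasible_bounds[OF assms(2)] by simp
    then show "F (Suc j) - F j \<le> g_max T D S d y"
      using delay_le_g_max[OF assms(2) j] by (simp add: F_def algebra_simps)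
  qed
  finally have "T + \<nu> * D T \<le> S * g_max T D S d y" by simp
  moreover have "0 < S" using feasible_load_ex[OF assms(2)] by (cases S) auto
  ultimately show ?thesis by (simp add: field_simps)
qed

lemma OPT_greatest:
  assumes "feasible C T \<nu> D S d y" "\<And>d y. feasible C T \<nu> D S d y \<Longrightarrow> a \<le> g_max T D S d y"
  shows "a \<le> OPT C T \<nu> D S"
  unfolding OPT_def by (rule cInf_greatest) (use assms in auto)

lemma OPT_ge_average:
  assumes "strict_mono_on {0..T} D" "feasible C T \<nu> D S d y"
  shows "(T + \<nu> * D T) / S \<le> OPT C T \<nu> D S"
  using OPT_greatest[OF assms(2)] g_max_ge_average[OF assms(1)] by blast

end


section \<open>Running time of the bisection\<close>

lemma greedy_time: "\<exists>r. greedy C T \<nu> D h n = Some (r, 1 + 11 * n)"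
proof (induction n)
  case (Suc n)
  then show ?case by (auto simp: step_def return_def bind_comp_def)
qed (simp add: step_def return_def bind_comp_def)

lemma solve_time:
  assumes "solve C T \<nu> D S h = Some (r, t)"
  shows "t = 4 + 11 * S"
proof -
  obtain d y where "greedy C T \<nu> D h S = Some ((d, y), 1 + 11 * S)"
    using greedy_time[of C T \<nu> D h S] by auto
  then show ?thesis using assms by (auto simp: solve_def step_def return_def bind_comp_def)
qed

definition gap_test :: "real \<Rightarrow> real \<times> real \<Rightarrow> bool comp" where
  "gap_test \<rho> = (\<lambda>(hplus, hminus). do { w \<leftarrow> step (hplus - hminus); step (w > \<rho>) })"

definition halve ::
  "real \<Rightarrow> real \<Rightarrow> real \<Rightarrow> (real \<Rightarrow> real) \<Rightarrow> nat \<Rightarrow> real \<times> real \<Rightarrow> (real \<times> real) comp" where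
  "halve C T \<nu> D S = (\<lambda>(hplus, hminus). do {
     w \<leftarrow> step (hplus + hminus);
     h \<leftarrow> step (w / 2);
     (ok, _, _) \<leftarrow> solve C T \<nu> D S h;
     return (if ok then (h, hminus) else (hplus, h))
   })"

lemma gap_test_eq: "gap_test \<rho> (p, m) = Some (p - m > \<rho>, 2)"
  by (simp add: gap_test_def step_def bind_comp_def)

lemma while_comp_gap:
  "while_comp (gap_test \<rho>) c (p, m) =
    (if p - m > \<rho> then
       (case c (p, m) of None \<Rightarrow> None | Some (s, a) \<Rightarrow>
          (case while_comp (gap_test \<rho>) c s of None \<Rightarrow> None
           | Some (r, b) \<Rightarrow> Some (r, 2 + (a + b))))
     else Some ((p, m), 2))"
  by (subst while_comp.simps)
     (auto simp: gap_test_eq bind_comp_def return_def split: option.splits)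

lemma binary_search_eq:
  "binary_search C T \<nu> D S \<rho> =
    (case while_comp (gap_test \<rho>) (halve C T \<nu> D S) (T + \<nu> * D T, 0) of None \<Rightarrow> None
     | Some ((p, m), a) \<Rightarrow>
         (case solve C T \<nu> D S p of None \<Rightarrow> None
          | Some ((ok, d, y), b) \<Rightarrow> Some ((d, y), 3 + (a + b))))"
  unfolding binary_search_def gap_test_def[symmetric] halve_def[symmetric]
  by (auto simp: step_def bind_comp_def return_def split: option.splits prod.splits)

context demand
begin

text \<open>
  The invariant of the bisection. It bounds the lower end by every feasible value instead of by
  their infimum \<open>OPT\<close>, so that preserving it needs no attainment or nonemptiness argument.
\<close>

definition brackets :: "nat \<Rightarrow> real \<Rightarrow> real \<Rightarrow> bool" where
  "brackets S p m \<longleftrightarrow> 0 \<le> m \<and> m \<le> p \<and> (\<exists>d y. solves_S C T \<nu> D S p d y) \<and>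
     (\<forall>d y. feasible C T \<nu> D S d y \<longrightarrow> m \<le> g_max T D S d y)"

lemma halve_correct:
  assumes "brackets S p m"
  shows "\<exists>p' m'. halve C T \<nu> D S (p, m) = Some ((p', m'), 6 + 11 * S) \<and> brackets S p' m' \<and>
    p' - m' = (p - m) / 2 \<and> p' \<le> p"
proof -
  define h where "h = (p + m) / 2"
  have m: "0 \<le> m" "m \<le> p" using assms by (auto simp: brackets_def)
  then have h: "0 \<le> h" "m \<le> h" "h \<le> p" by (auto simp: h_def)
  obtain ok d y t where run: "solve C T \<nu> D S h = Some ((ok, d, y), t)"
    and ok: "if ok then solves_S C T \<nu> D S h d y else \<nexists>d y. solves_S C T \<nu> D S h d y"
    using solve_correct[OF C_nonneg T_nonneg \<nu>_nonneg demand h(1), of S] by blast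
  have t: "t = 4 + 11 * S" by (rule solve_time[OF run])
  have halve: "halve C T \<nu> D S (p, m) = Some (if ok then (h, m) else (p, h), 6 + 11 * S)"
    using run t by (simp add: halve_def step_def return_def bind_comp_def h_def)
  show ?thesis
  proof (cases ok)
    case True
    then have "brackets S h m" using ok assms h by (auto simp: brackets_def)
    moreover have "h - m = (p - m) / 2" by (simp add: h_def field_simps)
    ultimately show ?thesis using halve True h by auto
  next
    case False
    then have "h \<le> g_max T D S d y" if "feasible C T \<nu> D S d y" for d y
      using ok solvable_if_g_max_le[OF that, of h] by force
    then have "brackets S p h" using assms h by (auto simp: brackets_def)
    moreover have "p - h = (p - m) / 2" by (simp add: h_def field_simps)
    ultimately show ?thesis using halve False by auto
  qed
qed

lemma bisection_correct:
  assumes "brackets S p m" "p - m \<le> \<rho> * 2 ^ k"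
  shows "\<exists>p' m' t. while_comp (gap_test \<rho>) (halve C T \<nu> D S) (p, m) = Some ((p', m'), t) \<and>
    brackets S p' m' \<and> p' - m' \<le> \<rho> \<and> p' \<le> p \<and> t \<le> 2 + k * (8 + 11 * S)"
  using assms
proof (induction k arbitrary: p m)
  case 0
  then show ?case by (simp add: while_comp_gap)
next
  case (Suc k)
  show ?case
  proof (cases "p - m > \<rho>")
    case False
    then show ?thesis using Suc.prems by (simp add: while_comp_gap)
  next
    case True
    obtain q n where h: "halve C T \<nu> D S (p, m) = Some ((q, n), 6 + 11 * S)" "brackets S q n"
      "q - n = (p - m) / 2" "q \<le> p"
      using halve_correct[OF Suc.prems(1)] by blast
    have "q - n \<le> \<rho> * 2 ^ k" using h(3) Suc.prems(2) by simp
    from Suc.IH[OF h(2) this] obtain p' m' t where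
      w: "while_comp (gap_test \<rho>) (halve C T \<nu> D S) (q, n) = Some ((p', m'), t)"
      "brackets S p' m'" "p' - m' \<le> \<rho>" "p' \<le> q" "t \<le> 2 + k * (8 + 11 * S)"
      by blast
    have "while_comp (gap_test \<rho>) (halve C T \<nu> D S) (p, m) = Some ((p', m'), 2 + (6 + 11 * S + t))"
      using True h(1) w(1) by (simp add: while_comp_gap[of \<rho> _ p m])
    moreover have "2 + (6 + 11 * S + t) \<le> 2 + Suc k * (8 + 11 * S)" using w(5) by simp
    moreover have "p' \<le> p" using w(4) h(4) by simp
    ultimately show ?thesis using w(2,3) by blast
  qed
qed

text \<open>
  The second bound on the objective value serves the degenerate case \<open>T + \<nu> * D T = 0\<close>, where
  the optimum is \<open>0\<close> and no positive accuracy is proportional to it.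
\<close>

lemma binary_search_correct:
  assumes feas: "feasible C T \<nu> D S d0 y0" and gap: "T + \<nu> * D T \<le> \<rho> * 2 ^ k"
  shows "\<exists>d y t. binary_search C T \<nu> D S \<rho> = Some ((d, y), t) \<and> feasible C T \<nu> D S d y \<and>
    g_max T D S d y \<le> OPT C T \<nu> D S + \<rho> \<and> g_max T D S d y \<le> T + \<nu> * D T \<and>
    t \<le> 9 + 11 * S + k * (8 + 11 * S)"
proof -
  have "0 \<le> T + \<nu> * D T" using T_nonneg \<nu>_nonneg DT_pos by simp
  then have "brackets S (T + \<nu> * D T) 0"
    using solvable_initially[OF feas] g_max_nonneg by (auto simp: brackets_def)
  then obtain p m a where
    w: "while_comp (gap_test \<rho>) (halve C T \<nu> D S) (T + \<nu> * D T, 0) = Some ((p, m), a)"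
    "brackets S p m" "p - m \<le> \<rho>" "p \<le> T + \<nu> * D T" "a \<le> 2 + k * (8 + 11 * S)"
    using bisection_correct[of S "T + \<nu> * D T" 0 \<rho> k] gap by auto
  have p: "0 \<le> p" using w(2) by (simp add: brackets_def)
  obtain ok d y b where run: "solve C T \<nu> D S p = Some ((ok, d, y), b)"
    and ok: "if ok then solves_S C T \<nu> D S p d y else \<nexists>d y. solves_S C T \<nu> D S p d y"
    using solve_correct[OF C_nonneg T_nonneg \<nu>_nonneg demand p, of S] by blast
  have sol: "solves_S C T \<nu> D S p d y"
    using ok w(2) by (auto simp: brackets_def split: if_splits)
  have "m \<le> OPT C T \<nu> D S"
    by (rule OPT_greatest[OF feas]) (use w(2) in \<open>auto simp: brackets_def\<close>)
  moreover have "g_max T D S d y = p" "feasible C T \<nu> D S d y"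
    using solves_S_feasible[OF sol p] by auto
  moreover have "binary_search C T \<nu> D S \<rho> = Some ((d, y), 3 + (a + b))"
    using w(1) run by (simp add: binary_search_eq)
  moreover have "3 + (a + b) \<le> 9 + 11 * S + k * (8 + 11 * S)"
    using w(5) solve_time[OF run] by simp
  ultimately show ?thesis using w(3,4) by fastforce
qed

end


section \<open>The approximation guarantee\<close>

theorem corollary1:
  fixes C T \<nu> :: real and D :: "real \<Rightarrow> real"
  assumes "0 \<le> C" and "0 \<le> T" and "0 \<le> \<nu>"
    and "cumulative_demand T D"
    and "strict_mono_on {0..T} D"
  shows "\<exists>K::real. \<forall>(S::nat) (\<epsilon>::real).
    S \<ge> 1 \<longrightarrow> \<epsilon> > 0 \<longrightarrow> (\<exists>d y. feasible C T \<nu> D S d y) \<longrightarrow>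
    (\<exists>\<rho>>0. \<exists>d y t.
       binary_search C T \<nu> D S \<rho> = Some ((d, y), t) \<and>
       real t \<le> K * (real S * max 1 (log 2 (real S / \<epsilon>))) \<and>
       feasible C T \<nu> D S d y \<and>
       g_max T D S d y \<le> (1 + \<epsilon>) * OPT C T \<nu> D S)"
proof (rule exI[of _ "58::real"], intro allI impI)
  interpret demand C T \<nu> D by unfold_locales (use assms in auto)
  fix S :: nat and \<epsilon> :: real
  assume S: "S \<ge> 1" and \<epsilon>: "\<epsilon> > 0" and "\<exists>d y. feasible C T \<nu> D S d y"
  then obtain d0 y0 where feas: "feasible C T \<nu> D S d0 y0" by blast
  define h0 where "h0 = T + \<nu> * D T"
  define \<rho> where "\<rho> = (if h0 = 0 then 1 else \<epsilon> * h0 / S)"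
  define M where "M = max 1 (log 2 (real S / \<epsilon>))"
  define k where "k = nat \<lceil>log 2 (real S / \<epsilon>)\<rceil>"
  have h0: "0 \<le> h0" using assms DT_pos by (simp add: h0_def)
  have \<rho>: "0 < \<rho>" using h0 \<epsilon> S by (simp add: \<rho>_def)
  have pos: "0 < real S / \<epsilon>" using S \<epsilon> by simp
  have "log 2 (real S / \<epsilon>) \<le> k" by (simp add: k_def real_nat_ceiling_ge)
  then have "real S / \<epsilon> \<le> 2 ^ k"
    using pos by (simp add: log_le_iff powr_realpow)
  then have gap: "h0 \<le> \<rho> * 2 ^ k"
    using S \<epsilon> h0 mult_left_mono[of "real S / \<epsilon>" "2 ^ k" "\<epsilon> * h0 / S"] by (simp add: \<rho>_def)
  from binary_search_correct[OF feas gap[unfolded h0_def]]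
  obtain d y t where res: "binary_search C T \<nu> D S \<rho> = Some ((d, y), t)" "feasible C T \<nu> D S d y"
    "g_max T D S d y \<le> OPT C T \<nu> D S + \<rho>" "g_max T D S d y \<le> h0"
    "t \<le> 9 + 11 * S + k * (8 + 11 * S)"
    by (auto simp: h0_def)
  have opt: "h0 / S \<le> OPT C T \<nu> D S"
    using OPT_ge_average[OF assms(5) feas] by (simp add: h0_def)
  have "g_max T D S d y \<le> (1 + \<epsilon>) * OPT C T \<nu> D S"
  proof (cases "h0 = 0")
    case True
    then have "0 \<le> (1 + \<epsilon>) * OPT C T \<nu> D S" using opt \<epsilon> by simp
    then show ?thesis using res(4) True by simp
  next
    case False
    have "\<rho> = \<epsilon> * (h0 / S)" using False by (simp add: \<rho>_def)
    also have "\<dots> \<le> \<epsilon> * OPT C T \<nu> D S" using opt \<epsilon> by (intro mult_left_mono) auto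
    finally show ?thesis using res(3) by (simp add: algebra_simps)
  qed
  moreover have "real t \<le> 58 * (real S * M)"
  proof -
    have M: "1 \<le> M" by (simp add: M_def)
    have "real k \<le> 2 * M" unfolding k_def M_def by linarith
    \<comment> \<open>As \<open>1 \<le> S\<close>, the additive constants \<open>9\<close> and \<open>8\<close> are absorbed into the linear terms.\<close>
    have "t \<le> 20 * S + k * (19 * S)"
    proof -
      have "k * (8 + 11 * S) \<le> k * (19 * S)" using S by (intro mult_left_mono) auto
      then show ?thesis using res(5) S by linarith
    qed
    then have "real t \<le> real (20 * S + k * (19 * S))" by (simp only: of_nat_le_iff)
    also have "\<dots> = (20 + 19 * real k) * S" by (simp add: algebra_simps)
    also have "\<dots> \<le> (58 * M) * S"
      using \<open>real k \<le> 2 * M\<close> M by (intro mult_right_mono) auto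
    finally show ?thesis by (simp add: algebra_simps)
  qed
  ultimately show "\<exists>\<rho>>0. \<exists>d y t.
       binary_search C T \<nu> D S \<rho> = Some ((d, y), t) \<and>
       real t \<le> 58 * (real S * max 1 (log 2 (real S / \<epsilon>))) \<and>
       feasible C T \<nu> D S d y \<and>
       g_max T D S d y \<le> (1 + \<epsilon>) * OPT C T \<nu> D S"
    using \<rho> res(1,2) unfolding M_def by blast
qed

end
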